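(* Let $a<b$, let $\nu$ be a Borel probability measure on $[a,b]$ that admits a density with respect to the Lebesgue measure, and let $k\in C^\infty([a,b]^2)$ be a positive-definite kernel that is totally positive of order $1$. Then, for any $n\in\mathbb{N}$ and any set $X=\{x_1,\ldots,x_n\}\subset[a,b]$ of $n$ distinct points, at least $\lfloor (n+1)/2\rfloor$ of the Bayesian quadrature weights $w_{X,1}^{\mathrm{BQ}},\ldots,w_{X,n}^{\mathrm{BQ}}$ are positive.
   Context: A kernel $k\colon [a,b]\times[a,b]\to\mathbb{R}$ is positive-definite if it is symmetric and for any distinct points $X=\{x_1,\ldots,x_n\}$ the kernel matrix $K_X$, $[K_X]_{ij}=k(x_j,x_i)$, is (strictly) positive-definite, hence invertible. The Bayesian quadrature weights for $X$ are $w_X^{\mathrm{BQ}}=(w_{X,i}^{\mathrm{BQ}})_{i=1}^n = K_X^{-1}k_{\nu,X}\in\mathbb{R}^n$, where $[k_{\nu,X}]_i=k_\nu(x_i)$ and $k_\nu(x)=\int_a^b k(y,x)\,\mathrm{d}\nu(y)$. $k\in C^\infty([a,b]^2)$ means that the derivatives $\frac{\partial^{2j}}{\partial x^j\partial y^j}k(x,y)$ exist and are continuous for every $j\in\mathbb{N}_0$. Write $k_y^{(j)}(x)=\frac{\partial^j}{\partial z^j}k(x,z)\big|_{z=y}$. A collection $\{\phi_i\}_{i=1}^m\subset C^{m-1}([a,b])$ is an (extended) Chebyshev system if any non-trivial linear combination of $\phi_1,\dots,\phi_m$ has at most $m-1$ zeroes, counting multiplicities. (A zero $x$ of $\phi$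 has multiplicity $q$ if $\phi^{(j)}(x)=0$ for $j=0,\ldots,q-1$.) A kernel $k\in C^\infty([a,b]^2)$ is (extended) totally positive of order $q\in\mathbb{N}$ if the collection $\{k_{x_i}^{(j_i)} : i=1,\ldots,m,\ j_i=0,\ldots,q_i-1\}$ is a Chebyshev system for any $m\in\mathbb{N}$, any distinct $x_1,\ldots,x_m\in[a,b]$ and any multiplicities $q_1,\ldots,q_m\le q$. In particular, for order $1$, the translates $k(\cdot,x_1),\ldots,k(\cdot,x_m)$ always form a Chebyshev system. *)

theory Defs
  imports
    "HOL-Analysis.Analysis"
    "HOL-Probability.Probability_Measure"
    "Jordan_Normal_Form.Gauss_Jordan_Elimination"
begin

unbundle no vec_syntax
unbundle no inner_syntax

text \<open>
  Derivatives are taken within \<open>S\<close>, so they are one-sided at the endpoints of an interval, and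
  the values of a function outside \<open>S\<close> play no role.
\<close>

definition nth_deriv_on :: "real set \<Rightarrow> nat \<Rightarrow> (real \<Rightarrow> real) \<Rightarrow> real \<Rightarrow> real" where
  "nth_deriv_on S j f = ((\<lambda>g x. vector_derivative g (at x within S)) ^^ j) f"

definition times_differentiable_on :: "nat \<Rightarrow> (real \<Rightarrow> real) \<Rightarrow> real set \<Rightarrow> bool" where
  "times_differentiable_on j f S \<longleftrightarrow> (\<forall>i<j. nth_deriv_on S i f differentiable_on S)"

definition C_on :: "nat \<Rightarrow> (real \<Rightarrow> real) \<Rightarrow> real set \<Rightarrow> bool" where
  "C_on j f S \<longleftrightarrow> times_differentiable_on j f S \<and> continuous_on S (nth_deriv_on S j f)"

definition smooth_kernel :: "real \<Rightarrow> real \<Rightarrow> (real \<Rightarrow> real \<Rightarrow> real) \<Rightarrow> bool" where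
  "smooth_kernel a b k \<longleftrightarrow>
     (\<forall>j.
        (\<forall>x\<in>{a..b}. times_differentiable_on j (\<lambda>y. k x y) {a..b}) \<and>
        (\<forall>y\<in>{a..b}. times_differentiable_on j (\<lambda>x. nth_deriv_on {a..b} j (\<lambda>z. k x z) y) {a..b}) \<and>
        continuous_on ({a..b} \<times> {a..b})
          (\<lambda>(x, y). nth_deriv_on {a..b} j (\<lambda>u. nth_deriv_on {a..b} j (\<lambda>z. k u z) y) x))"

definition kernel_matrix :: "(real \<Rightarrow> real \<Rightarrow> real) \<Rightarrow> nat \<Rightarrow> (nat \<Rightarrow> real) \<Rightarrow> real mat" where
  "kernel_matrix k n X = mat n n (\<lambda>(i, j). k (X j) (X i))"

definition positive_definite_mat :: "nat \<Rightarrow> real mat \<Rightarrow> bool" where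
  "positive_definite_mat n A \<longleftrightarrow>
     A \<in> carrier_mat n n \<and> A\<^sup>T = A \<and>
     (\<forall>v\<in>carrier_vec n. v \<noteq> 0\<^sub>v n \<longrightarrow> 0 < v \<bullet> (A *\<^sub>v v))"

definition positive_definite_kernel :: "real \<Rightarrow> real \<Rightarrow> (real \<Rightarrow> real \<Rightarrow> real) \<Rightarrow> bool" where
  "positive_definite_kernel a b k \<longleftrightarrow>
     (\<forall>x\<in>{a..b}. \<forall>y\<in>{a..b}. k x y = k y x) \<and>
     (\<forall>n X. X ` {..<n} \<subseteq> {a..b} \<longrightarrow> inj_on X {..<n} \<longrightarrow>
        positive_definite_mat n (kernel_matrix k n X))"

definition kernel_mean :: "(real \<Rightarrow> real \<Rightarrow> real) \<Rightarrow> real measure \<Rightarrow> real \<Rightarrow> real" where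
  "kernel_mean k \<nu> x = (\<integral>y. k y x \<partial>\<nu>)"

text \<open>
  \<open>mat_inverse\<close> returns \<open>None\<close> on singular matrices, which does not happen for the kernel matrix of
  a positive-definite kernel at distinct points.
\<close>

definition bq_weights ::
  "(real \<Rightarrow> real \<Rightarrow> real) \<Rightarrow> real measure \<Rightarrow> nat \<Rightarrow> (nat \<Rightarrow> real) \<Rightarrow> real vec" where
  "bq_weights k \<nu> n X =
     the (mat_inverse (kernel_matrix k n X)) *\<^sub>v vec n (\<lambda>i. kernel_mean k \<nu> (X i))"

definition zero_of_multiplicity :: "real set \<Rightarrow> (real \<Rightarrow> real) \<Rightarrow> real \<Rightarrow> nat \<Rightarrow> bool" where
  "zero_of_multiplicity S f x q \<longleftrightarrow> (\<forall>j<q. nth_deriv_on S j f x = 0)"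

text \<open>
  The members of the system form a family indexed by the finite set \<open>I\<close>, so equal functions at
  different indices count separately. That a linear combination has at most \<open>card I - 1\<close> zeros
  counted with multiplicity means that every choice of finitely many zeros, each with a
  multiplicity that it attains, has total multiplicity less than \<open>card I\<close>. Derivatives are only
  assumed to exist up to order \<open>card I - 1\<close>, so multiplicities above \<open>card I\<close> are not considered;
  one zero of multiplicity \<open>card I\<close> already violates the bound.
\<close>

definition chebyshev_system ::
  "real \<Rightarrow> real \<Rightarrow> 'i set \<Rightarrow> ('i \<Rightarrow> real \<Rightarrow> real) \<Rightarrow> bool" where
  "chebyshev_system a b I \<phi> \<longleftrightarrow>
     finite I \<and>
     (\<forall>i\<in>I. C_on (card I - 1) (\<phi> i) {a..b}) \<and>
     (\<forall>c. (\<exists>i\<in>I. c i \<noteq> 0) \<longrightarrow>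
        (\<forall>Z q. finite Z \<longrightarrow> Z \<subseteq> {a..b} \<longrightarrow>
           (\<forall>z\<in>Z. q z \<le> card I \<and> zero_of_multiplicity {a..b} (\<lambda>x. \<Sum>i\<in>I. c i * \<phi> i x) z (q z)) \<longrightarrow>
           (\<Sum>z\<in>Z. q z) < card I))"

text \<open>The function with index \<open>(i, j)\<close> is the \<open>j\<close>-th derivative in \<open>y\<close> of \<open>k(\<cdot>, y)\<close> at \<open>y = x\<^sub>i\<close>.\<close>

definition totally_positive ::
  "real \<Rightarrow> real \<Rightarrow> nat \<Rightarrow> (real \<Rightarrow> real \<Rightarrow> real) \<Rightarrow> bool" where
  "totally_positive a b q k \<longleftrightarrow>
     (\<forall>(m::nat) X r. X ` {..<m} \<subseteq> {a..b} \<longrightarrow> inj_on X {..<m} \<longrightarrow> (\<forall>i<m. 1 \<le> r i \<and> r i \<le> q) \<longrightarrow>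
        chebyshev_system a b (SIGMA i:{..<m}. {..<r i})
          (\<lambda>(i, j) x. nth_deriv_on {a..b} j (\<lambda>z. k x z) (X i)))"

end

theory Submission
  imports Defs "Jordan_Normal_Form.Determinant"
begin

text \<open>
  The weights make the quadrature rule exact on the span of the translates \<open>k(\<cdot>, x\<^sub>i)\<close>: since
  \<open>K w = k\<^sub>\<nu>\<close>, every \<open>f\<close> in this span satisfies \<open>\<integral> f d\<nu> = \<Sum>\<^sub>j w\<^sub>j f(x\<^sub>j)\<close>
  (\<open>kernel_mean_eq_bq_sum\<close>). Suppose that only \<open>p\<close> weights are positive, with \<open>2p + 1 \<le> n\<close>. It is
  then enough to find \<open>f \<ge> 0\<close> in the span that vanishes exactly at the \<open>p\<close> nodes with positive
  weight. Each term \<open>w\<^sub>j f(x\<^sub>j)\<close> of the rule is at most \<open>0\<close>, so \<open>\<integral> f d\<nu> \<le> 0\<close>; but \<open>\<nu>\<close> has a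
  density, so it does not charge the finitely many zeros of \<open>f\<close> and \<open>\<integral> f d\<nu> > 0\<close>
  (\<open>integral_pos_if_finitely_many_zeros\<close>).

  Such an \<open>f\<close> is found with double zeros at the \<open>p\<close> nodes
  (\<open>chebyshev_system_nonneg_double_zeros\<close>). By total positivity any \<open>2p + 1\<close> of the translates are
  already a Chebyshev system, so the surplus translates can be discarded and no surplus zeros have
  to be placed. The \<open>2p\<close> linear conditions \<open>f(z) = f'(z) = 0\<close> on \<open>2p + 1\<close> coefficients have a
  non-trivial solution, and the prescribed zeros use up all of the at most \<open>2p\<close> zeros that it may
  have. Hence \<open>f\<close> has no other zero and \<open>f''(z) \<noteq> 0\<close> at each of them, so \<open>f\<close> never changes
  sign (\<open>constant_sign_if_zeros_double\<close>), and \<open>f\<close> or \<open>-f\<close> is as required.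
\<close>

section \<open>Underdetermined homogeneous linear systems\<close>

text \<open>
  Gaussian elimination over arbitrary finite index sets: one equation with a nonzero coefficient
  expresses one unknown through the others, which leaves one equation and one unknown fewer.
\<close>

lemma homogeneous_system_nontrivial_solution:
  fixes A :: "'e \<Rightarrow> 'i \<Rightarrow> real"
  assumes "finite E" "finite I" "card E < card I"
  shows "\<exists>c. (\<exists>i\<in>I. c i \<noteq> 0) \<and> (\<forall>e\<in>E. (\<Sum>i\<in>I. c i * A e i) = 0)"
  using assms
proof (induction E arbitrary: I A rule: finite_induct)
  case empty
  then have "I \<noteq> {}" by auto
  then show ?case by (intro exI[of _ "\<lambda>_. 1"]) auto
next
  case (insert e E)
  show ?case
  proof (cases "\<forall>i\<in>I. A e i = 0")
    case True
    have "card E < card I" using insert by simp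
    from insert.IH[OF insert.prems(1) this, of A] True show ?thesis by auto
  next
    case False
    then obtain p where p: "p \<in> I" "A e p \<noteq> 0" by blast
    let ?J = "I - {p}"
    have cJ: "finite ?J" "card E < card ?J" using insert p by auto
    from insert.IH[OF cJ, of "\<lambda>e' i. A e' i - A e' p * A e i / A e p"]
    obtain d where d: "\<exists>i\<in>?J. d i \<noteq> 0"
      "\<forall>e'\<in>E. (\<Sum>i\<in>?J. d i * (A e' i - A e' p * A e i / A e p)) = 0" by blast
    define c where "c = d(p := - (\<Sum>i\<in>?J. d i * A e i) / A e p)"
    have split: "(\<Sum>i\<in>I. c i * A e' i) = c p * A e' p + (\<Sum>i\<in>?J. d i * A e' i)" for e'
    proof -
      have "(\<Sum>i\<in>I. c i * A e' i) = c p * A e' p + (\<Sum>i\<in>?J. c i * A e' i)"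
        using insert.prems(1) p(1) by (rule sum.remove)
      also have "(\<Sum>i\<in>?J. c i * A e' i) = (\<Sum>i\<in>?J. d i * A e' i)"
        by (rule sum.cong) (auto simp: c_def)
      finally show ?thesis .
    qed
    have "(\<Sum>i\<in>I. c i * A e i) = 0"
      unfolding split using p(2) by (simp add: c_def)
    moreover have "(\<Sum>i\<in>I. c i * A e' i) = 0" if "e' \<in> E" for e'
    proof -
      have "0 = (\<Sum>i\<in>?J. d i * A e' i - (A e' p / A e p) * (d i * A e i))"
        using d(2) that by (simp add: algebra_simps)
      also have "\<dots> = (\<Sum>i\<in>?J. d i * A e' i) - (A e' p / A e p) * (\<Sum>i\<in>?J. d i * A e i)"
        by (simp add: sum_subtractf sum_distrib_left)
      finally show ?thesis unfolding split by (simp add: c_def algebra_simps)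
    qed
    moreover have "\<exists>i\<in>I. c i \<noteq> 0" using d(1) by (auto simp: c_def)
    ultimately show ?thesis by auto
  qed
qed

section \<open>Derivatives of linear combinations\<close>

lemma nth_deriv_on_0 [simp]: "nth_deriv_on S 0 f = f"
  by (simp add: nth_deriv_on_def)

lemma nth_deriv_on_Suc:
  "nth_deriv_on S (Suc j) f x = vector_derivative (nth_deriv_on S j f) (at x within S)"
  by (simp add: nth_deriv_on_def)

lemma has_vector_derivative_nth_deriv_on:
  assumes "times_differentiable_on m f S" "j < m" "x \<in> S"
  shows "(nth_deriv_on S j f has_vector_derivative nth_deriv_on S (Suc j) f x) (at x within S)"
  using assms
  by (auto simp: times_differentiable_on_def nth_deriv_on_Suc differentiable_on_def
      vector_derivative_works)

text \<open>
  The function \<open>G\<close> stands for the \<open>j\<close>-th derivative of the linear combination, which is given by the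
  derivatives of the summands only on the interval; this is the induction step for the next lemma.
\<close>

lemma has_vector_derivative_linear_combination:
  fixes \<phi> :: "'i \<Rightarrow> real \<Rightarrow> real"
  assumes "\<And>i. i \<in> I \<Longrightarrow> times_differentiable_on m (\<phi> i) {a..b}"
    and "j < m" "x \<in> {a..b}"
    and eq: "\<And>y. y \<in> {a..b} \<Longrightarrow> G y = (\<Sum>i\<in>I. c i * nth_deriv_on {a..b} j (\<phi> i) y)"
  shows "(G has_vector_derivative (\<Sum>i\<in>I. c i * nth_deriv_on {a..b} (Suc j) (\<phi> i) x))
    (at x within {a..b})"
proof -
  have "((\<lambda>y. \<Sum>i\<in>I. c i * nth_deriv_on {a..b} j (\<phi> i) y) has_vector_derivative
      (\<Sum>i\<in>I. c i * nth_deriv_on {a..b} (Suc j) (\<phi> i) x)) (at x within {a..b})"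
    using assms
    by (intro has_vector_derivative_sum has_vector_derivative_mult_right
        has_vector_derivative_nth_deriv_on) auto
  then show ?thesis
    by (rule has_vector_derivative_transform[OF assms(3), rotated]) (use eq in auto)
qed

lemma nth_deriv_on_linear_combination:
  fixes \<phi> :: "'i \<Rightarrow> real \<Rightarrow> real"
  assumes "a < b" "\<And>i. i \<in> I \<Longrightarrow> times_differentiable_on m (\<phi> i) {a..b}"
    and "j \<le> m" "x \<in> {a..b}"
  shows "nth_deriv_on {a..b} j (\<lambda>x. \<Sum>i\<in>I. c i * \<phi> i x) x
    = (\<Sum>i\<in>I. c i * nth_deriv_on {a..b} j (\<phi> i) x)"
  using assms(3,4)
proof (induction j arbitrary: x)
  case (Suc j)
  have "(nth_deriv_on {a..b} j (\<lambda>x. \<Sum>i\<in>I. c i * \<phi> i x) has_vector_derivative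
      (\<Sum>i\<in>I. c i * nth_deriv_on {a..b} (Suc j) (\<phi> i) x)) (at x within {a..b})"
    using Suc assms(1,2) by (intro has_vector_derivative_linear_combination[where m=m]) auto
  then show ?case
    unfolding nth_deriv_on_Suc[of _ j "\<lambda>x. \<Sum>i\<in>I. c i * \<phi> i x"]
    using Suc.prems assms(1)
    by (intro vector_derivative_within_cbox[of a b, folded interval_cbox]) auto
qed simp

lemma times_differentiable_on_linear_combination:
  fixes \<phi> :: "'i \<Rightarrow> real \<Rightarrow> real"
  assumes "a < b" "\<And>i. i \<in> I \<Longrightarrow> times_differentiable_on m (\<phi> i) {a..b}"
  shows "times_differentiable_on m (\<lambda>x. \<Sum>i\<in>I. c i * \<phi> i x) {a..b}"
  unfolding times_differentiable_on_def differentiable_on_def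
proof (intro allI impI ballI)
  fix j x assume "j < m" "x \<in> {a..b}"
  then have "(nth_deriv_on {a..b} j (\<lambda>x. \<Sum>i\<in>I. c i * \<phi> i x) has_vector_derivative
      (\<Sum>i\<in>I. c i * nth_deriv_on {a..b} (Suc j) (\<phi> i) x)) (at x within {a..b})"
    using assms
    by (intro has_vector_derivative_linear_combination[where m=m]
        nth_deriv_on_linear_combination[where m=m]) auto
  then show "nth_deriv_on {a..b} j (\<lambda>x. \<Sum>i\<in>I. c i * \<phi> i x) differentiable at x within {a..b}"
    by (rule differentiableI_vector)
qed

section \<open>Functions whose zeros are all exactly double\<close>

text \<open>
  As \<open>f'\<close> has positive slope at its zero \<open>z\<close>, it is negative just to the left and positive just to
  the right of \<open>z\<close>, so \<open>f\<close> increases away from \<open>z\<close> on both sides. Derivatives within the interval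
  cover the case that \<open>z\<close> is an endpoint.
\<close>

lemma positive_near_double_zero:
  fixes f :: "real \<Rightarrow> real"
  assumes f: "\<And>x. x \<in> {a..b} \<Longrightarrow> (f has_real_derivative f' x) (at x within {a..b})"
    and f': "(f' has_real_derivative D) (at z within {a..b})"
    and z: "z \<in> {a..b}" "f z = 0" "f' z = 0" and "D > 0"
  shows "\<forall>\<^sub>F x in at z within {a..b}. f x > 0"
proof -
  obtain r where r: "r > 0" "\<And>h. h > 0 \<Longrightarrow> z + h \<in> {a..b} \<Longrightarrow> h < r \<Longrightarrow> f' z < f' (z + h)"
    using has_real_derivative_pos_inc_right[OF f' \<open>D > 0\<close>] by blast
  obtain l where l: "l > 0" "\<And>h. h > 0 \<Longrightarrow> z - h \<in> {a..b} \<Longrightarrow> h < l \<Longrightarrow> f' (z - h) < f' z"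
    using has_real_derivative_pos_inc_left[OF f' \<open>D > 0\<close>] by blast
  have deriv: "(f has_derivative (*) (f' x)) (at x within {u..v})"
    if "x \<in> {u..v}" "{u..v} \<subseteq> {a..b}" for x u v
    using f[of x] that has_derivative_subset unfolding has_field_derivative_def by blast
  have "f x > 0" if x: "x \<in> {a..b}" "x \<noteq> z" "dist x z < min r l" for x
  proof (cases "z < x")
    case True
    have sub: "{z..x} \<subseteq> {a..b}" using x z by auto
    obtain y where y: "y \<in> {z<..<x}" "f x - f z = f' y * (x - z)"
      using mvt_simple[OF True, of f "\<lambda>y. (*) (f' y)"] deriv[OF _ sub] by auto
    have "f' y > 0" using r(2)[of "y - z"] y(1) x z by (auto simp: dist_real_def)
    then show ?thesis using y(2) z(2) True by simp
  next
    case False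
    then have xz: "x < z" using x by simp
    have sub: "{x..z} \<subseteq> {a..b}" using x z by auto
    obtain y where y: "y \<in> {x<..<z}" "f z - f x = f' y * (z - x)"
      using mvt_simple[OF xz, of f "\<lambda>y. (*) (f' y)"] deriv[OF _ sub] by auto
    have "f' y < 0" using l(2)[of "z - y"] y(1) x z by (auto simp: dist_real_def)
    then have "f' y * (z - x) < 0" using xz by (simp add: mult_neg_pos)
    then show ?thesis using y(2) z(2) by linarith
  qed
  then show ?thesis
    unfolding eventually_at using r(1) l(1) by (intro exI[of _ "min r l"]) auto
qed

text \<open>
  Give each point of the interval the sign of \<open>f\<close>, or the sign of \<open>f''\<close> if it is a zero. This sign
  is locally constant, by continuity away from the zeros and by the previous lemma at the zeros, so
  it is constant because the interval is connected. Two derivatives are demanded only in the presence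
  of zeros, because a single function forms a Chebyshev system if it is merely continuous and has
  no zero.
\<close>

lemma constant_sign_if_zeros_double:
  fixes f :: "real \<Rightarrow> real"
  assumes cont: "continuous_on {a..b} f"
    and diff: "Z \<noteq> {} \<Longrightarrow> times_differentiable_on 2 f {a..b}"
    and Z: "Z \<subseteq> {a..b}" "\<And>x. x \<in> {a..b} \<Longrightarrow> f x = 0 \<longleftrightarrow> x \<in> Z"
    and double: "\<And>z. z \<in> Z \<Longrightarrow> nth_deriv_on {a..b} 1 f z = 0"
      "\<And>z. z \<in> Z \<Longrightarrow> nth_deriv_on {a..b} 2 f z \<noteq> 0"
  shows "(\<forall>x\<in>{a..b}. f x \<ge> 0) \<or> (\<forall>x\<in>{a..b}. f x \<le> 0)"
proof -
  define D where "D = nth_deriv_on {a..b} 2 f"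
  define U where "U s = {x\<in>{a..b}. s * f x > 0 \<or> (x \<in> Z \<and> s * D x > 0)}" for s :: real
  have open_U: "openin (top_of_set {a..b}) (U s)" for s
  proof -
    have "\<forall>\<^sub>F y in at x within {a..b}. s * f y > 0" if "x \<in> U s" for x
    proof (cases "s * f x > 0")
      case True
      have "((\<lambda>y. s * f y) \<longlongrightarrow> s * f x) (at x within {a..b})"
        using cont that unfolding U_def continuous_on_def by (auto intro: tendsto_mult_left)
      then show ?thesis using True by (rule order_tendstoD)
    next
      case False
      then have x: "x \<in> Z" "s * D x > 0" "x \<in> {a..b}" using that by (auto simp: U_def)
      then have d2: "times_differentiable_on 2 f {a..b}" using diff by auto
      have f: "(f has_real_derivative nth_deriv_on {a..b} 1 f y) (at y within {a..b})"
        if "y \<in> {a..b}" for y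
        using has_vector_derivative_nth_deriv_on[OF d2, of 0 y] that
        by (simp add: has_real_derivative_iff_has_vector_derivative)
      have f': "(nth_deriv_on {a..b} 1 f has_real_derivative D x) (at x within {a..b})"
        using has_vector_derivative_nth_deriv_on[OF d2, of 1 x] x(3)
        by (simp add: has_real_derivative_iff_has_vector_derivative D_def numeral_2_eq_2)
      \<comment> \<open>Scaling by \<open>s\<close> reduces a zero with \<open>f'' < 0\<close>, where \<open>s < 0\<close>, to one with positive slope of \<open>f'\<close>.\<close>
      show ?thesis
        by (rule positive_near_double_zero[where f = "\<lambda>y. s * f y"
              and f' = "\<lambda>y. s * nth_deriv_on {a..b} 1 f y", OF DERIV_cmult[OF f] DERIV_cmult[OF f']])
          (use x double Z in auto)
    qed
    then have "\<exists>d>0. \<forall>y\<in>{a..b}. dist y x < d \<longrightarrow> y \<in> U s" if "x \<in> U s" for x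
      using that unfolding eventually_at U_def by (smt (verit) mem_Collect_eq)
    then show ?thesis
      unfolding openin_euclidean_subtopology_iff by (auto simp: U_def)
  qed
  have "{a..b} \<subseteq> U 1 \<union> U (-1)"
    using Z double(2) by (force simp: U_def D_def)
  moreover have "U 1 \<inter> U (-1) = {}"
    using Z(2) by (fastforce simp: U_def)
  moreover have "connected {a..b}" by simp
  ultimately have "U 1 = {} \<or> U (-1) = {}"
    using open_U unfolding connected_openin by blast
  then show ?thesis
    unfolding U_def by (force simp: not_less)
qed

section \<open>Nonnegative elements of a Chebyshev space\<close>

text \<open>
  The number of functions is exactly one more than the number of vanishing conditions: this leaves
  room for a non-trivial solution, and none for a further zero, which would be the zero number
  \<open>card I\<close>. For the same reason no prescribed zero can have multiplicity three.
\<close>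

lemma chebyshev_system_nonneg_double_zeros:
  fixes \<phi> :: "'i \<Rightarrow> real \<Rightarrow> real"
  assumes ab: "a < b" and cheb: "chebyshev_system a b I \<phi>"
    and Z: "finite Z" "Z \<subseteq> {a..b}" and card: "card I = 2 * card Z + 1"
  obtains c where "\<And>x. x \<in> {a..b} \<Longrightarrow> (\<Sum>i\<in>I. c i * \<phi> i x) \<ge> 0"
    and "\<And>x. x \<in> {a..b} \<Longrightarrow> (\<Sum>i\<in>I. c i * \<phi> i x) = 0 \<longleftrightarrow> x \<in> Z"
proof -
  have I: "finite I" and C: "\<And>i. i \<in> I \<Longrightarrow> C_on (2 * card Z) (\<phi> i) {a..b}"
    using cheb card by (auto simp: chebyshev_system_def)
  have "card (Z \<times> {..<2::nat}) < card I"
    using card by (simp add: card_cartesian_product)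
  from homogeneous_system_nontrivial_solution[OF _ I this,
      of "\<lambda>(z, j) i. nth_deriv_on {a..b} j (\<phi> i) z"]
  obtain c where c: "\<exists>i\<in>I. c i \<noteq> 0"
    "\<And>z j. z \<in> Z \<Longrightarrow> j < 2 \<Longrightarrow> (\<Sum>i\<in>I. c i * nth_deriv_on {a..b} j (\<phi> i) z) = 0"
    using Z(1) by auto
  define f where "f = (\<lambda>x. \<Sum>i\<in>I. c i * \<phi> i x)"
  have diffs: "times_differentiable_on (2 * card Z) (\<phi> i) {a..b}" if "i \<in> I" for i
    using C[OF that] by (simp add: C_on_def)
  have diff: "times_differentiable_on (2 * card Z) f {a..b}"
    unfolding f_def using ab diffs by (rule times_differentiable_on_linear_combination)
  have pos: "card Z > 0" if "z \<in> Z" for z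
    using that Z(1) by (auto simp: card_gt_0_iff)
  have zero: "nth_deriv_on {a..b} j f z = 0" if "z \<in> Z" "j < 2" for z j
    unfolding f_def using nth_deriv_on_linear_combination[OF ab diffs, where j=j and c=c and x=z]
      c(2)[OF that] pos[OF that(1)] that Z(2) by auto
  have bound: "(\<Sum>z\<in>Y. q z) < card I"
    if "finite Y" "Y \<subseteq> {a..b}" "\<And>z. z \<in> Y \<Longrightarrow> q z \<le> card I"
      "\<And>z j. z \<in> Y \<Longrightarrow> j < q z \<Longrightarrow> nth_deriv_on {a..b} j f z = 0" for Y and q :: "real \<Rightarrow> nat"
  proof -
    have "\<forall>Y q. finite Y \<longrightarrow> Y \<subseteq> {a..b} \<longrightarrow>
        (\<forall>z\<in>Y. q z \<le> card I \<and> zero_of_multiplicity {a..b} f z (q z)) \<longrightarrow> (\<Sum>z\<in>Y. q z) < card I"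
      using cheb c(1) unfolding chebyshev_system_def f_def by simp
    then show ?thesis using that by (simp add: zero_of_multiplicity_def)
  qed
  have only: "f x = 0 \<longleftrightarrow> x \<in> Z" if "x \<in> {a..b}" for x
  proof
    assume "f x = 0"
    show "x \<in> Z"
    proof (rule ccontr)
      assume "x \<notin> Z"
      then have "(\<Sum>z\<in>Z. if z = x then 1 else 2 :: nat) = (\<Sum>z\<in>Z. 2)"
        by (intro sum.cong) auto
      then have "(\<Sum>z\<in>insert x Z. if z = x then 1 else 2 :: nat) = card I"
        using Z(1) \<open>x \<notin> Z\<close> card by simp
      moreover have "(\<Sum>z\<in>insert x Z. if z = x then 1 else 2 :: nat) < card I"
      proof (rule bound)
        fix z j assume "z \<in> insert x Z" "j < (if z = x then 1 else 2 :: nat)"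
        then show "nth_deriv_on {a..b} j f z = 0"
          using zero \<open>f x = 0\<close> by (auto split: if_splits)
      next
        fix z assume "z \<in> insert x Z"
        then show "(if z = x then 1 else 2 :: nat) \<le> card I"
          using pos[of z] card by auto
      qed (use Z that in auto)
      ultimately show False by simp
    qed
  next
    assume "x \<in> Z"
    then show "f x = 0" using zero[of x 0] by simp
  qed
  have nonzero2: "nth_deriv_on {a..b} 2 f z \<noteq> 0" if "z \<in> Z" for z
  proof
    assume 0: "nth_deriv_on {a..b} 2 f z = 0"
    have "(\<Sum>y\<in>Z. if y = z then 3 else 2 :: nat) = 3 + 2 * card (Z - {z})"
      using Z(1) that by (simp add: sum.remove[of Z z])
    then have "(\<Sum>y\<in>Z. if y = z then 3 else 2 :: nat) = card I"
      using card Z(1) that pos[OF that] by simp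
    moreover have "(\<Sum>y\<in>Z. if y = z then 3 else 2 :: nat) < card I"
    proof (rule bound)
      fix y j assume "y \<in> Z" "j < (if y = z then 3 else 2 :: nat)"
      then show "nth_deriv_on {a..b} j f y = 0"
        using zero 0 by (cases "j = 2") (auto split: if_splits)
    qed (use Z card pos[OF that] in auto)
    ultimately show False by simp
  qed
  \<comment> \<open>Without zeros \<open>I\<close> is a singleton and only continuity of its member is known.\<close>
  have cont: "continuous_on {a..b} f"
  proof -
    have "continuous_on {a..b} (\<phi> i)" if "i \<in> I" for i
    proof (cases "card Z = 0")
      case True
      then show ?thesis using C[OF that] by (simp add: C_on_def)
    next
      case False
      then show ?thesis
        using diffs[OF that] unfolding times_differentiable_on_def
        by (intro differentiable_imp_continuous_on) (auto dest: spec[of _ 0])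
    qed
    then show ?thesis unfolding f_def by (intro continuous_intros)
  qed
  have diff2: "times_differentiable_on 2 f {a..b}" if "Z \<noteq> {}"
    using diff pos that unfolding times_differentiable_on_def by fastforce
  from constant_sign_if_zeros_double[OF cont diff2 Z(2) only] zero nonzero2
  consider "\<forall>x\<in>{a..b}. f x \<ge> 0" | "\<forall>x\<in>{a..b}. f x \<le> 0" by auto
  then show thesis
  proof cases
    case 1
    then show thesis using only that[of c] unfolding f_def by blast
  next
    case 2
    have "(\<Sum>i\<in>I. (- c i) * \<phi> i x) = - f x" for x
      by (simp add: f_def sum_negf)
    then show thesis using 2 only that[of "\<lambda>i. - c i"] by simp
  qed
qed

section \<open>Exactness of Bayesian quadrature on kernel translates\<close>

lemma positive_definite_mat_inverse:
  assumes "positive_definite_mat n K"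
  obtains B where "mat_inverse K = Some B" "B \<in> carrier_mat n n" "K * B = 1\<^sub>m n"
proof -
  have K: "K \<in> carrier_mat n n" using assms by (simp add: positive_definite_mat_def)
  have "Determinant.det K \<noteq> 0"
  proof
    assume "Determinant.det K = 0"
    then obtain v where v: "v \<in> carrier_vec n" "v \<noteq> 0\<^sub>v n" "K *\<^sub>v v = 0\<^sub>v n"
      using det_0_iff_vec_prod_zero[OF K] by auto
    then have "v \<bullet> (K *\<^sub>v v) = 0" by simp
    then show False using assms v unfolding positive_definite_mat_def by fastforce
  qed
  then have "K \<in> Units (ring_mat TYPE(real) n ())"
    by (rule det_non_zero_imp_unit[OF K])
  then obtain B where B: "mat_inverse K = Some B"
    using mat_inverse(1)[OF K, where b = "()"] by (cases "mat_inverse K") auto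
  from mat_inverse(2)[OF K B] B that show thesis by blast
qed

text \<open>
  Row \<open>i\<close> of \<open>K w = k\<^sub>\<nu>\<close>, which says that the quadrature rule integrates the translate
  \<open>k(\<cdot>, x\<^sub>i)\<close> exactly.
\<close>

lemma kernel_mean_eq_bq_sum:
  assumes "positive_definite_kernel a b k" "X ` {..<n} \<subseteq> {a..b}" "inj_on X {..<n}" "i < n"
  shows "kernel_mean k \<nu> (X i) = (\<Sum>j<n. bq_weights k \<nu> n X $ j * k (X j) (X i))"
proof -
  define K where "K = kernel_matrix k n X"
  define m where "m = vec n (\<lambda>i. kernel_mean k \<nu> (X i))"
  define w where "w = bq_weights k \<nu> n X"
  have "positive_definite_mat n K"
    using assms unfolding positive_definite_kernel_def K_def by blast
  then obtain B where B: "mat_inverse K = Some B" "B \<in> carrier_mat n n" "K * B = 1\<^sub>m n"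
    by (rule positive_definite_mat_inverse)
  have K: "K \<in> carrier_mat n n" by (simp add: K_def kernel_matrix_def)
  have m: "m \<in> carrier_vec n" by (simp add: m_def)
  have w: "w = B *\<^sub>v m" using B(1) by (simp add: w_def bq_weights_def K_def m_def)
  then have "K *\<^sub>v w = m"
    using assoc_mult_mat_vec[OF K B(2) m] B(3) m by simp
  then have "kernel_mean k \<nu> (X i) = (K *\<^sub>v w) $ i" using assms(4) by (simp add: m_def)
  also have "\<dots> = (\<Sum>j<n. w $ j * k (X j) (X i))"
    using assms(4) B(2) w K
    by (simp add: K_def kernel_matrix_def scalar_prod_def atLeast0LessThan mult.commute)
  finally show ?thesis by (simp add: w_def)
qed

section \<open>Positivity of the integral and of the weights\<close>

lemma integral_pos_if_finitely_many_zeros: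
  fixes f :: "real \<Rightarrow> real"
  assumes "prob_space \<nu>" and sp: "space \<nu> = S"
    and dens: "p \<in> borel_measurable (restrict_space lborel S)"
      "\<nu> = density (restrict_space lborel S) p" and S: "S \<in> sets borel"
    and int: "integrable \<nu> f" and nonneg: "\<And>x. x \<in> S \<Longrightarrow> f x \<ge> 0"
    and Z: "finite Z" "\<And>x. x \<in> S \<Longrightarrow> f x = 0 \<Longrightarrow> x \<in> Z"
  shows "(\<integral>x. f x \<partial>\<nu>) > 0"
proof -
  interpret prob_space \<nu> by fact
  have ge: "AE x in \<nu>. 0 \<le> f x" using nonneg sp by (intro AE_I2) auto
  have "AE x in lborel. x \<notin> Z"
    using finite_imp_null_set_lborel[OF Z(1)] by (rule AE_not_in)
  then have "AE x in restrict_space lborel S. x \<notin> Z"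
    using S by (subst AE_restrict_space_iff) auto
  then have notZ: "AE x in \<nu>. x \<notin> Z"
    unfolding dens(2) by (subst AE_density[OF dens(1)]) auto
  have "(\<integral>x. f x \<partial>\<nu>) \<noteq> 0"
  proof
    assume "(\<integral>x. f x \<partial>\<nu>) = 0"
    then have "AE x in \<nu>. f x = 0" using integral_nonneg_eq_0_iff_AE[OF int ge] by simp
    with notZ AE_space have "AE x in \<nu>. False"
      by eventually_elim (use Z(2) sp in auto)
    then show False by simp
  qed
  moreover have "(\<integral>x. f x \<partial>\<nu>) \<ge> 0" using ge by (rule integral_nonneg_AE)
  ultimately show ?thesis by simp
qed

theorem theorem1:
  fixes a b :: real
    and \<nu> :: "real measure"
    and k :: "real \<Rightarrow> real \<Rightarrow> real"
    and n :: nat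
    and X :: "nat \<Rightarrow> real"
  assumes "a < b"
    and "prob_space \<nu>"
    and "sets \<nu> = sets (restrict_space borel {a..b})"
    and "\<exists>p \<in> borel_measurable (restrict_space lborel {a..b}).
           \<nu> = density (restrict_space lborel {a..b}) p"
    and "smooth_kernel a b k"
    and "positive_definite_kernel a b k"
    and "totally_positive a b 1 k"
    and "X ` {..<n} \<subseteq> {a..b}"
    and "inj_on X {..<n}"
  shows "card {i. i < n \<and> bq_weights k \<nu> n X $ i > 0} \<ge> (n + 1) div 2"
proof (rule ccontr)
  let ?w = "\<lambda>j. bq_weights k \<nu> n X $ j"
  define P where "P = {i. i < n \<and> ?w i > 0}"
  assume "\<not> ?thesis"
  then have few: "2 * card P + 1 \<le> n" by (simp add: P_def)
  define m where "m = 2 * card P + 1"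
  have mn: "m \<le> n" using few by (simp add: m_def)
  define Z where "Z = X ` P"
  have P: "finite P" "P \<subseteq> {..<n}" by (auto simp: P_def)
  have Z: "finite Z" "Z \<subseteq> {a..b}" using P assms(8) by (auto simp: Z_def)
  have cardZ: "card Z = card P"
    unfolding Z_def using P assms(9) by (meson card_image inj_on_subset)
  define I where "I = (SIGMA i:{..<m}. {..<1::nat})"
  define \<phi> where "\<phi> = (\<lambda>(i, j) x. nth_deriv_on {a..b} j (\<lambda>z. k x z) (X i))"
  \<comment> \<open>The first \<open>m\<close> nodes serve to select \<open>m\<close> translates; they need not include the nodes in \<open>Z\<close>.\<close>
  have sub: "X ` {..<m} \<subseteq> {a..b}" "inj_on X {..<m}"
    using assms(8,9) mn by (auto intro: inj_on_subset)
  have cheb: "chebyshev_system a b I \<phi>"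
    using assms(7)[unfolded totally_positive_def, rule_format, OF sub, of "\<lambda>_. 1"]
    unfolding I_def \<phi>_def by simp
  have "card I = 2 * card Z + 1" by (simp add: I_def cardZ m_def)
  from chebyshev_system_nonneg_double_zeros[OF assms(1) cheb Z this]
  obtain c where c: "\<And>x. x \<in> {a..b} \<Longrightarrow> (\<Sum>i\<in>I. c i * \<phi> i x) \<ge> 0"
    "\<And>x. x \<in> {a..b} \<Longrightarrow> (\<Sum>i\<in>I. c i * \<phi> i x) = 0 \<longleftrightarrow> x \<in> Z" by blast
  \<comment> \<open>At order \<open>1\<close> the derivative index is always \<open>0\<close>, so it can be dropped.\<close>
  define d where "d i = c (i, 0)" for i
  define f where "f x = (\<Sum>i<m. d i * k x (X i))" for x
  have f_eq: "(\<Sum>i\<in>I. c i * \<phi> i x) = f x" for x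
  proof -
    have "I = (\<lambda>i. (i, 0)) ` {..<m}" by (auto simp: I_def)
    then show ?thesis
      by (simp add: sum.reindex inj_on_def f_def d_def \<phi>_def)
  qed
  have nonneg: "f x \<ge> 0" if "x \<in> {a..b}" for x using c(1)[OF that] f_eq by simp
  have zeros: "f x = 0 \<longleftrightarrow> x \<in> Z" if "x \<in> {a..b}" for x using c(2)[OF that] f_eq by simp

  interpret prob_space \<nu> by fact
  have sp: "space \<nu> = {a..b}"
    using sets_eq_imp_space_eq[OF assms(3)] by (simp add: space_restrict_space)
  have int: "integrable \<nu> (\<lambda>x. k x (X i))" if "i < n" for i
  proof -
    have "X i \<in> {a..b}" using assms(8) that by auto
    moreover have "continuous_on ({a..b} \<times> {a..b}) (\<lambda>(x, y). k x y)"
      using assms(5)[unfolded smooth_kernel_def, rule_format, of 0] by simp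
    ultimately have cont: "continuous_on {a..b} (\<lambda>x. k x (X i))"
      using continuous_on_compose2[of "{a..b} \<times> {a..b}" "\<lambda>(x, y). k x y" "{a..b}" "\<lambda>x. (x, X i)"]
      by (simp add: continuous_on_Pair image_subset_iff)
    then have "(\<lambda>x. k x (X i)) \<in> borel_measurable (restrict_space borel {a..b})"
      by (rule borel_measurable_continuous_on_restrict)
    then have meas: "(\<lambda>x. k x (X i)) \<in> borel_measurable \<nu>"
      using measurable_cong_sets[OF assms(3) refl] by blast
    have "bounded ((\<lambda>x. k x (X i)) ` {a..b})"
      using cont compact_continuous_image compact_imp_bounded by blast
    then obtain M where "\<forall>x\<in>{a..b}. norm (k x (X i)) \<le> M"
      unfolding bounded_iff by auto
    then show ?thesis
      using meas sp by (intro integrable_const_bound[where B=M] AE_I2) auto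
  qed
  have int_f: "integrable \<nu> f"
    unfolding f_def using int mn by (intro Bochner_Integration.integrable_sum integrable_mult_right) auto
  have "(\<integral>x. f x \<partial>\<nu>) = (\<Sum>i<m. d i * kernel_mean k \<nu> (X i))"
    unfolding f_def kernel_mean_def using int mn
    by (subst Bochner_Integration.integral_sum) (auto intro!: integrable_mult_right sum.cong)
  also have "\<dots> = (\<Sum>i<m. \<Sum>j<n. d i * (?w j * k (X j) (X i)))"
    using kernel_mean_eq_bq_sum[OF assms(6,8,9)] mn by (simp add: sum_distrib_left)
  also have "\<dots> = (\<Sum>j<n. ?w j * f (X j))"
    unfolding f_def by (subst sum.swap) (simp add: sum_distrib_left mult.left_commute)
  also have "\<dots> \<le> 0"
  proof (rule sum_nonpos)
    fix j assume j: "j \<in> {..<n}"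
    then have Xj: "X j \<in> {a..b}" using assms(8) by auto
    show "?w j * f (X j) \<le> 0"
    proof (cases "j \<in> P")
      case True
      then show ?thesis using zeros[OF Xj] by (simp add: Z_def)
    next
      case False
      then show ?thesis using j nonneg[OF Xj] by (simp add: P_def mult_nonpos_nonneg)
    qed
  qed
  finally have "(\<integral>x. f x \<partial>\<nu>) \<le> 0" .
  moreover obtain p where "p \<in> borel_measurable (restrict_space lborel {a..b})"
    "\<nu> = density (restrict_space lborel {a..b}) p" using assms(4) by blast
  then have "(\<integral>x. f x \<partial>\<nu>) > 0"
    using nonneg zeros Z(1)
    by (intro integral_pos_if_finitely_many_zeros[OF assms(2) sp _ _ _ int_f]) auto
  ultimately show False by simp
qed

end
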